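(* Let $h\colon\mathcal{X}\to\mathcal{Y}$ be a classifier with conditional risk $r(x)=\sum_{y\in\mathcal{Y}}p(y\mid x)\,\ell(y,h(x))$, and let $\lambda>0$ be a target risk. Consider the problem $$\max_{c\in[0,1]^{\mathcal{X}}}\ \phi(c)\quad\text{s.t.}\quad R_S(h,c)\le\lambda, \qquad (P)$$ and assume that a maximizer exists. Let $\bar r(x)=r(x)-\lambda$, $\rho(\mathcal{X}')=\int_{\mathcal{X}'}p(x)\bar r(x)\,dx$ for $\mathcal{X}'\subseteq\mathcal{X}$, $b=\sup\{a\mid\rho(\mathcal{X}_{\bar r(x)\le a})\le 0\}\ge 0$, and $\gamma=b+\lambda$. Define $$c^*(x)=\begin{cases}1&\text{if } r(x)<\gamma,\\ \tau&\text{if } r(x)=\gamma,\\ 0&\text{if } r(x)>\gamma,\end{cases}\qquad \tau=\begin{cases}1&\text{if }\rho(\mathcal{X}_{r(x)=\gamma})=0,\\[1mm] -\dfrac{\rho(\mathcal{X}_{r(x)<\gamma})}{\rho(\mathcal{X}_{r(x)=\gamma})}&\text{if }\rho(\mathcal{X}_{r(x)=\gamma})>0.\end{cases}$$ Then $c^*$ satisfies the conditions $$\int_{\mathcal{X}_{\bar r(x)<b}}p(x)c^*(x)\,dx=\int_{\mathcal{X}_{\bar r(x)<b}}p(x)\,dx,$$ $$\int_{\mathcal{X}_{\bar r(x)=b}}p(x)c^*(x)\,dx=\begin{cases}-\dfrac{\rho(\mathcal{X}_{\bar r(x)<b})}{b}&\text{if } b>0,\\[2mm] \displaystyle\int_{\mathcal{X}_{\bar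 r(x)=0}}p(x)\,dx&\text{if } b=0,\end{cases}$$ $$\int_{\mathcal{X}_{\bar r(x)>b}}p(x)c^*(x)\,dx=0,$$ and hence $c^*$ is an optimal solution to $(P)$.
   Context: $\mathcal{X}$ is a set of inputs (a measurable space with a fixed reference measure $dx$), $\mathcal{Y}$ is a finite set of labels, $p(x,y)$ is a probability density on $\mathcal{X}\times\mathcal{Y}$ (with respect to $dx$ times counting measure), $p(x)=\sum_{y\in\mathcal{Y}}p(x,y)$ is its marginal, and $p(y\mid x)$ is the conditional distribution, so $p(x,y)=p(x)p(y\mid x)$. $\ell\colon\mathcal{Y}\times\mathcal{Y}\to[0,\infty)$ is a loss. A classifier is a function $h\colon\mathcal{X}\to\mathcal{Y}$, a selection function is a function $c\colon\mathcal{X}\to[0,1]$; all functions and sets are taken measurable. The coverage of $c$ is $\phi(c)=\int_{\mathcal{X}}p(x)c(x)\,dx$, and the selective risk of $(h,c)$ is $$R_S(h,c)=\frac{\int_{\mathcal{X}}\sum_{y\in\mathcal{Y}}p(x,y)\,\ell(y,h(x))\,c(x)\,dx}{\phi(c)},$$ defined when $\phi(c)\neq 0$; $c$ is feasible only if $R_S(h,c)$ is defined. For $f\colon\mathcal{X}\to\mathbb{R}$ and $a\in\mathbb{R}\cup\{\infty\}$, $\mathcal{X}_{f(x)\le a}=\{x\in\mathcal{X}\mid f(x)\le a\}$, and similarly for $<,=,>,\ge$. The supremum $b$ is taken in $\mathbb{R}\cup\{\infty\}$; if $b=\infty$ then $\gamma=\infty$ and $\rho(\mathcal{X}_{\bar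 r(x)<b})/b$ is read as $0$. *)

theory Defs
  imports "HOL-Probability.Probability"
begin

text \<open>The reference measure on the inputs is \<open>M\<close>, the input space is \<^term>\<open>space M\<close>, and the labels
  are the finite set \<open>Y\<close> with its discrete sigma-algebra. A joint density is a function of the pair
  \<open>(x, y)\<close>.\<close>

definition prob_density :: "'x measure \<Rightarrow> 'y set \<Rightarrow> ('x \<times> 'y \<Rightarrow> real) \<Rightarrow> bool" where
  "prob_density M Y p \<longleftrightarrow>
     p \<in> borel_measurable (M \<Otimes>\<^sub>M count_space Y) \<and>
     (\<forall>x\<in>space M. \<forall>y\<in>Y. 0 \<le> p (x, y)) \<and>
     prob_space (density (M \<Otimes>\<^sub>M count_space Y) (\<lambda>z. ennreal (p z)))"

definition marginal :: "'y set \<Rightarrow> ('x \<times> 'y \<Rightarrow> real) \<Rightarrow> 'x \<Rightarrow> real" where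
  "marginal Y p x = (\<Sum>y\<in>Y. p (x, y))"

text \<open>\<open>q x y\<close> is the probability of the label \<open>y\<close> given the input \<open>x\<close>. Where the marginal is zero
  the joint density does not determine it; any measurable choice of a distribution is allowed.\<close>

definition cond_dist ::
  "'x measure \<Rightarrow> 'y set \<Rightarrow> ('x \<times> 'y \<Rightarrow> real) \<Rightarrow> ('x \<Rightarrow> 'y \<Rightarrow> real) \<Rightarrow> bool" where
  "cond_dist M Y p q \<longleftrightarrow>
     (\<forall>y\<in>Y. (\<lambda>x. q x y) \<in> borel_measurable M) \<and>
     (\<forall>x\<in>space M. (\<forall>y\<in>Y. 0 \<le> q x y) \<and> (\<Sum>y\<in>Y. q x y) = 1) \<and>
     (\<forall>x\<in>space M. \<forall>y\<in>Y. p (x, y) = marginal Y p x * q x y)"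

definition cond_risk ::
  "'y set \<Rightarrow> ('x \<Rightarrow> 'y \<Rightarrow> real) \<Rightarrow> ('y \<Rightarrow> 'y \<Rightarrow> real) \<Rightarrow> ('x \<Rightarrow> 'y) \<Rightarrow> 'x \<Rightarrow> real" where
  "cond_risk Y q l h x = (\<Sum>y\<in>Y. q x y * l y (h x))"

definition selection_function :: "'x measure \<Rightarrow> ('x \<Rightarrow> real) \<Rightarrow> bool" where
  "selection_function M c \<longleftrightarrow>
     c \<in> borel_measurable M \<and> (\<forall>x\<in>space M. 0 \<le> c x \<and> c x \<le> 1)"

definition coverage ::
  "'x measure \<Rightarrow> 'y set \<Rightarrow> ('x \<times> 'y \<Rightarrow> real) \<Rightarrow> ('x \<Rightarrow> real) \<Rightarrow> real" where
  "coverage M Y p c = (LINT x|M. marginal Y p x * c x)"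

definition selective_risk ::
  "'x measure \<Rightarrow> 'y set \<Rightarrow> ('x \<times> 'y \<Rightarrow> real) \<Rightarrow> ('y \<Rightarrow> 'y \<Rightarrow> real) \<Rightarrow> ('x \<Rightarrow> 'y)
     \<Rightarrow> ('x \<Rightarrow> real) \<Rightarrow> real" where
  "selective_risk M Y p l h c =
     (LINT x|M. (\<Sum>y\<in>Y. p (x, y) * l y (h x)) * c x) / coverage M Y p c"

text \<open>The condition on the coverage says that the selective risk is defined; without it, division by
  zero would make every selection function of coverage zero feasible.\<close>

definition feasible ::
  "'x measure \<Rightarrow> 'y set \<Rightarrow> ('x \<times> 'y \<Rightarrow> real) \<Rightarrow> ('y \<Rightarrow> 'y \<Rightarrow> real) \<Rightarrow> ('x \<Rightarrow> 'y) \<Rightarrow> real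
     \<Rightarrow> ('x \<Rightarrow> real) \<Rightarrow> bool" where
  "feasible M Y p l h lam c \<longleftrightarrow>
     selection_function M c \<and> coverage M Y p c \<noteq> 0 \<and> selective_risk M Y p l h c \<le> lam"

definition optimal_solution ::
  "'x measure \<Rightarrow> 'y set \<Rightarrow> ('x \<times> 'y \<Rightarrow> real) \<Rightarrow> ('y \<Rightarrow> 'y \<Rightarrow> real) \<Rightarrow> ('x \<Rightarrow> 'y) \<Rightarrow> real
     \<Rightarrow> ('x \<Rightarrow> real) \<Rightarrow> bool" where
  "optimal_solution M Y p l h lam = is_arg_max (coverage M Y p) (feasible M Y p l h lam)"

text \<open>\<open>\<rho>(A)\<close> is the integral over \<open>A\<close> of the marginal times the excess risk \<open>s = r - \<lambda>\<close>.\<close>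

definition rho ::
  "'x measure \<Rightarrow> 'y set \<Rightarrow> ('x \<times> 'y \<Rightarrow> real) \<Rightarrow> ('x \<Rightarrow> real) \<Rightarrow> 'x set \<Rightarrow> real" where
  "rho M Y p s A = (LINT x:A|M. marginal Y p x * s x)"

end

theory Submission
  imports Defs
begin

text \<open>For a selection function of positive coverage, \<open>R\<^sub>S(h, c) \<le> \<lambda>\<close> is the linear constraint
  \<open>\<integral> p (r - \<lambda>) c \<le> 0\<close>, so the problem is a continuous knapsack problem and is solved as in the
  Neyman-Pearson lemma. If \<open>0 < b < \<infinity>\<close>, the choice of \<open>\<tau>\<close> makes the constraint tight and \<open>1 / b\<close> is
  a Lagrange multiplier. If \<open>b = 0\<close>, then \<open>r \<ge> \<lambda>\<close> almost surely, and a feasible \<open>c\<close> vanishes almost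
  surely where \<open>r > \<lambda>\<close>. If \<open>b = \<infinity>\<close>, selecting everything is feasible. As \<open>c\<^sup>*\<close>
  covers at least as much as an existing maximizer, its selective risk is defined.\<close>

section \<open>Integrability against a weight with bounded excess risk\<close>

text \<open>The labels are summed out here: \<open>m\<close> will be the marginal density and
  \<open>s\<close> the excess risk \<open>r - \<lambda>\<close>. A bound on \<open>s\<close> is
  available because finitely many labels give finitely many losses; it also means that a high enough
  level exhausts the whole space.\<close>

locale excess_risk =
  fixes M :: "'x measure" and m s :: "'x \<Rightarrow> real" and K :: real
  assumes m_integrable: "integrable M m"
    and m_nonneg: "\<And>x. x \<in> space M \<Longrightarrow> 0 \<le> m x"
    and s_measurable: "s \<in> borel_measurable M"
    and s_bounded: "\<And>x. x \<in> space M \<Longrightarrow> \<bar>s x\<bar> \<le> K"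
begin

lemmas [measurable] = s_measurable borel_measurable_integrable[OF m_integrable]

lemma integrable_mult_m:
  assumes [measurable]: "f \<in> borel_measurable M" and "\<And>x. x \<in> space M \<Longrightarrow> \<bar>f x\<bar> \<le> C"
  shows "integrable M (\<lambda>x. m x * f x)"
proof (rule Bochner_Integration.integrable_bound)
  show "integrable M (\<lambda>x. C * m x)"
    using m_integrable by simp
  show "AE x in M. norm (m x * f x) \<le> norm (C * m x)"
  proof (rule AE_I2)
    fix x assume "x \<in> space M"
    then have "\<bar>f x\<bar> \<le> \<bar>C\<bar>" using assms(2)[of x] by linarith
    then show "norm (m x * f x) \<le> norm (C * m x)"
      by (simp add: abs_mult mult.commute[of "\<bar>m x\<bar>"] mult_right_mono)
  qed
qed measurable

lemma integrable_m_s: "integrable M (\<lambda>x. m x * s x)"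
  by (rule integrable_mult_m[OF s_measurable s_bounded])

lemma integrable_m_s_mult:
  assumes [measurable]: "f \<in> borel_measurable M" and "\<And>x. x \<in> space M \<Longrightarrow> 0 \<le> f x \<and> f x \<le> 1"
  shows "integrable M (\<lambda>x. m x * s x * f x)"
proof -
  have "integrable M (\<lambda>x. m x * (s x * f x))"
  proof (rule integrable_mult_m)
    fix x assume x: "x \<in> space M"
    then have "\<bar>s x\<bar> * \<bar>f x\<bar> \<le> K * 1"
      using s_bounded[OF x] assms(2)[OF x] by (intro mult_mono) auto
    then show "\<bar>s x * f x\<bar> \<le> K" by (simp add: abs_mult)
  qed measurable
  then show ?thesis by (simp add: mult.assoc)
qed

lemma set_integrable_m_s:
  assumes "A \<in> sets M"
  shows "set_integrable M A (\<lambda>x. m x * s x)"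
  unfolding set_integrable_def using assms integrable_m_s by (rule integrable_mult_indicator)

section \<open>The integral over sublevel sets as a function of the level\<close>

text \<open>Continuity from above: the sets of level \<open>b + 1/(n+1)\<close> decrease exactly to
  \<open>{s \<le> b}\<close>, so the sign of their integrals passes to the limit.\<close>

lemma integral_upto_nonneg:
  assumes "\<And>a. b < a \<Longrightarrow> 0 \<le> (LINT x:{x\<in>space M. s x \<le> a}|M. m x * s x)"
  shows "0 \<le> (LINT x:{x\<in>space M. s x \<le> b}|M. m x * s x)"
proof -
  define A where "A n = {x\<in>space M. s x \<le> b + inverse (real (Suc n))}" for n
  have A: "(\<Inter>n. A n) = {x\<in>space M. s x \<le> b}"
  proof
    show "(\<Inter>n. A n) \<subseteq> {x\<in>space M. s x \<le> b}"
    proof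
      fix x assume x: "x \<in> (\<Inter>n. A n)"
      have "(\<lambda>n. b + inverse (real (Suc n))) \<longlonglongrightarrow> b + 0"
        by (intro tendsto_intros LIMSEQ_inverse_real_of_nat)
      then have "s x \<le> b + 0"
        by (rule LIMSEQ_le_const) (use x in \<open>auto simp: A_def\<close>)
      then show "x \<in> {x\<in>space M. s x \<le> b}" using x by (auto simp: A_def)
    qed
  qed (auto simp: A_def intro: order_trans)
  have [measurable]: "A n \<in> sets M" for n unfolding A_def by measurable
  have "(\<lambda>n. LINT x:A n|M. m x * s x) \<longlonglongrightarrow> (LINT x:(\<Inter>n. A n)|M. m x * s x)"
  proof (rule set_integral_cont_down)
    have "inverse (real (Suc n)) \<le> inverse (real (Suc k))" if "k \<le> n" for k n
      using that by (intro le_imp_inverse_le) auto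
    then have "x \<in> A k" if "k \<le> n" "x \<in> A n" for k n x
      using that unfolding A_def mem_Collect_eq by (metis add_left_mono order_trans)
    then show "decseq A" by (auto simp: decseq_def)
    show "set_integrable M (A 0) (\<lambda>x. m x * s x)"
      by (rule set_integrable_m_s) measurable
  qed measurable
  then show ?thesis unfolding A
    by (rule LIMSEQ_le_const) (use assms in \<open>auto simp: A_def\<close>)
qed

text \<open>Continuity from below: the sets of level \<open>b - 1/(n+1)\<close> increase to
  \<open>{s < b}\<close> only. They miss the level set \<open>{s = b}\<close>, which is where the
  integral may jump.\<close>

lemma integral_below_nonpos:
  assumes "\<And>a. a < b \<Longrightarrow> (LINT x:{x\<in>space M. s x \<le> a}|M. m x * s x) \<le> 0"
  shows "(LINT x:{x\<in>space M. s x < b}|M. m x * s x) \<le> 0"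
proof -
  define A where "A n = {x\<in>space M. s x \<le> b - inverse (real (Suc n))}" for n
  have A: "(\<Union>n. A n) = {x\<in>space M. s x < b}"
  proof
    show "{x\<in>space M. s x < b} \<subseteq> (\<Union>n. A n)"
    proof
      fix x assume x: "x \<in> {x\<in>space M. s x < b}"
      then obtain n where "inverse (real (Suc n)) < b - s x"
        using reals_Archimedean[of "b - s x"] by auto
      then show "x \<in> (\<Union>n. A n)" using x by (auto simp: A_def intro!: exI[of _ n])
    qed
    have "0 < inverse (real (Suc n))" for n by simp
    then show "(\<Union>n. A n) \<subseteq> {x\<in>space M. s x < b}"
      unfolding A_def by (smt (verit) UN_iff mem_Collect_eq subsetI)
  qed
  have [measurable]: "A n \<in> sets M" for n unfolding A_def by measurable
  have "(\<lambda>n. LINT x:A n|M. m x * s x) \<longlonglongrightarrow> (LINT x:(\<Union>n. A n)|M. m x * s x)"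
  proof (rule set_integral_cont_up)
    have "inverse (real (Suc n)) \<le> inverse (real (Suc k))" if "k \<le> n" for k n
      using that by (intro le_imp_inverse_le) auto
    then have "x \<in> A n" if "k \<le> n" "x \<in> A k" for k n x
      using that unfolding A_def mem_Collect_eq by (metis diff_left_mono order_trans)
    then show "incseq A" by (auto simp: incseq_def)
    show "set_integrable M (\<Union>n. A n) (\<lambda>x. m x * s x)"
      by (rule set_integrable_m_s) measurable
  qed measurable
  then show ?thesis unfolding A
    by (rule LIMSEQ_le_const2) (use assms in \<open>auto simp: A_def\<close>)
qed

text \<open>Raising the level from \<open>a \<ge> 0\<close> adds only points with
  \<open>s > 0\<close>. Among negative levels the added points contribute nonpositively, hence the
  restriction on \<open>a\<close>.\<close>

lemma integral_upto_mono:
  assumes "0 \<le> a" "a \<le> a'"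
  shows "(LINT x:{x\<in>space M. s x \<le> a}|M. m x * s x) \<le> (LINT x:{x\<in>space M. s x \<le> a'}|M. m x * s x)"
  unfolding set_lebesgue_integral_def
proof (rule integral_mono_AE)
  show "AE x in M. indicator {x\<in>space M. s x \<le> a} x *\<^sub>R (m x * s x)
      \<le> indicator {x\<in>space M. s x \<le> a'} x *\<^sub>R (m x * s x)"
    using assms m_nonneg by (intro AE_I2) (auto simp: indicator_def)
qed (rule set_integrable_m_s[unfolded set_integrable_def], measurable)+

lemma integral_upto_nonpos:
  assumes "a \<le> 0"
  shows "(LINT x:{x\<in>space M. s x \<le> a}|M. m x * s x) \<le> 0"
proof -
  have "0 \<le> (LINT x:{x\<in>space M. s x \<le> a}|M. - (m x * s x))"
    unfolding set_lebesgue_integral_def using assms m_nonneg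
    by (intro integral_nonneg_AE AE_I2) (auto simp: indicator_def intro!: mult_nonneg_nonpos)
  then show ?thesis by (simp add: set_lebesgue_integral_def)
qed

text \<open>Since \<open>s\<close> is constant on the level set, the mass of that set can be
  recovered from its excess risk when \<open>b > 0\<close>. For \<open>b = 0\<close> this excess
  risk vanishes whatever the mass is, which is why that case is separate.\<close>

lemma integral_level:
  "(LINT x:{x\<in>space M. s x = b}|M. m x * s x) = b * (LINT x:{x\<in>space M. s x = b}|M. m x)"
proof -
  have "(LINT x:{x\<in>space M. s x = b}|M. m x * s x) = (LINT x:{x\<in>space M. s x = b}|M. b * m x)"
    by (rule set_lebesgue_integral_cong) auto
  then show ?thesis by simp
qed

lemma integral_upto_split:
  "(LINT x:{x\<in>space M. s x \<le> b}|M. m x * s x) =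
   (LINT x:{x\<in>space M. s x < b}|M. m x * s x) + (LINT x:{x\<in>space M. s x = b}|M. m x * s x)"
proof -
  have "{x\<in>space M. s x \<le> b} = {x\<in>space M. s x < b} \<union> {x\<in>space M. s x = b}" by auto
  moreover have "(LINT x:{x\<in>space M. s x < b} \<union> {x\<in>space M. s x = b}|M. m x * s x) =
   (LINT x:{x\<in>space M. s x < b}|M. m x * s x) + (LINT x:{x\<in>space M. s x = b}|M. m x * s x)"
    by (rule set_integral_Un) (auto intro!: set_integrable_m_s)
  ultimately show ?thesis by simp
qed

lemma integral_level_nonneg: "0 \<le> (LINT x:{x\<in>space M. s x = b}|M. m x)"
  unfolding set_lebesgue_integral_def using m_nonneg
  by (intro integral_nonneg_AE AE_I2) (auto simp: indicator_def)

section \<open>Threshold rules and their optimality\<close>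

lemma integral_threshold:
  fixes b t :: real and w :: "'x \<Rightarrow> real"
  assumes [measurable]: "w \<in> borel_measurable M" and "integrable M w"
  shows "(LINT x|M. w x * (if s x < b then 1 else if s x = b then t else 0)) =
    (LINT x:{x\<in>space M. s x < b}|M. w x) + t * (LINT x:{x\<in>space M. s x = b}|M. w x)"
proof -
  have i: "integrable M (\<lambda>x. indicator A x *\<^sub>R w x)" if "A \<in> sets M" for A
    using assms that by (intro integrable_mult_indicator)
  have "(LINT x|M. w x * (if s x < b then 1 else if s x = b then t else 0)) =
     (LINT x|M. indicator {x\<in>space M. s x < b} x *\<^sub>R w x
        + t * (indicator {x\<in>space M. s x = b} x *\<^sub>R w x))"
    by (intro Bochner_Integration.integral_cong) (auto simp: indicator_def)
  also have "\<dots> = (LINT x|M. indicator {x\<in>space M. s x < b} x *\<^sub>R w x)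
        + (LINT x|M. t * (indicator {x\<in>space M. s x = b} x *\<^sub>R w x))"
    by (intro Bochner_Integration.integral_add integrable_mult_right i) measurable
  finally show ?thesis by (simp add: set_lebesgue_integral_def)
qed

text \<open>The multiplier \<open>b\<close> makes \<open>(s - b) * (c - c')\<close> nonnegative pointwise, as \<open>c'\<close> is extreme off the level
  set \<open>s = b\<close>.\<close>

lemma threshold_coverage_ge_pos:
  fixes b t :: real
  defines "c' \<equiv> \<lambda>x. if s x < b then 1 else if s x = b then t else 0"
  assumes "0 < b" and t: "0 \<le> t" "t \<le> 1" and c'0: "(LINT x|M. m x * s x * c' x) = 0"
    and [measurable]: "c \<in> borel_measurable M" and c: "\<And>x. x \<in> space M \<Longrightarrow> 0 \<le> c x \<and> c x \<le> 1"
    and c0: "(LINT x|M. m x * s x * c x) \<le> 0"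
  shows "(LINT x|M. m x * c x) \<le> (LINT x|M. m x * c' x)"
proof -
  have [measurable]: "c' \<in> borel_measurable M" unfolding c'_def by measurable
  have c': "0 \<le> c' x \<and> c' x \<le> 1" for x using t by (simp add: c'_def)
  have i: "integrable M (\<lambda>x. m x * c x)" "integrable M (\<lambda>x. m x * c' x)"
    "integrable M (\<lambda>x. m x * s x * c x)" "integrable M (\<lambda>x. m x * s x * c' x)"
    using c c' by (auto intro!: integrable_mult_m[where C = 1] integrable_m_s_mult)
  have "0 \<le> (LINT x|M. (m x * s x * c x - m x * s x * c' x) - b * (m x * c x - m x * c' x))"
  proof (intro integral_nonneg_AE AE_I2)
    fix x assume x: "x \<in> space M"
    have "0 \<le> (s x - b) * (c x - c' x)"
      using c[OF x] by (auto simp: c'_def intro!: mult_nonneg_nonneg mult_nonpos_nonpos)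
    then have "0 \<le> m x * ((s x - b) * (c x - c' x))" using m_nonneg[OF x] by simp
    then show "0 \<le> (m x * s x * c x - m x * s x * c' x) - b * (m x * c x - m x * c' x)"
      by (simp add: algebra_simps)
  qed
  also have "\<dots> = ((LINT x|M. m x * s x * c x) - (LINT x|M. m x * s x * c' x))
      - b * ((LINT x|M. m x * c x) - (LINT x|M. m x * c' x))"
    using i by simp
  \<comment> \<open>The integrated inequality compares Lagrangians: \<open>c'\<close> meets the
    constraint with equality and \<open>c\<close> has a nonpositive constraint integral, so only
    \<open>b\<close> times the coverage gap remains.\<close>
  finally have "b * ((LINT x|M. m x * c x) - (LINT x|M. m x * c' x)) \<le> 0"
    using c'0 c0 by linarith
  then show ?thesis using \<open>0 < b\<close> by (simp add: mult_le_0_iff)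
qed

text \<open>With \<open>b = 0\<close> there is no dividing by \<open>b\<close>, so the comparison is
  made pointwise almost everywhere. The two equal branches keep the shape of the threshold rule at
  \<open>b = 0\<close>, \<open>t = 1\<close>.\<close>

lemma threshold_coverage_ge_zero:
  assumes z: "(LINT x:{x\<in>space M. s x < 0}|M. m x * s x) = 0"
    and [measurable]: "c \<in> borel_measurable M" and c: "\<And>x. x \<in> space M \<Longrightarrow> 0 \<le> c x \<and> c x \<le> 1"
    and c0: "(LINT x|M. m x * s x * c x) \<le> 0"
  shows "(LINT x|M. m x * c x) \<le> (LINT x|M. m x * (if s x < 0 then 1 else if s x = 0 then 1 else 0))"
proof -
  have "integrable M (\<lambda>x. indicator {x\<in>space M. s x < 0} x *\<^sub>R - (m x * s x))"
    using integrable_m_s by (intro integrable_mult_indicator) auto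
  \<comment> \<open>A nonnegative function with integral zero vanishes almost everywhere; so
    \<open>m x * s x\<close> has no negative part.\<close>
  then have "AE x in M. indicator {x\<in>space M. s x < 0} x *\<^sub>R - (m x * s x) = 0"
    using z m_nonneg
    by (subst integral_nonneg_eq_0_iff_AE[symmetric])
      (auto simp: set_lebesgue_integral_def indicator_def intro!: AE_I2 mult_nonneg_nonpos)
  then have s0: "AE x in M. 0 \<le> m x * s x"
    using AE_space by eventually_elim (auto simp: indicator_def m_nonneg split: if_splits)
  have nn: "AE x in M. 0 \<le> m x * s x * c x"
    using s0 AE_space by eventually_elim (use c in auto)
  then have "(LINT x|M. m x * s x * c x) = 0"
    using c0 integral_nonneg_AE[OF nn] by linarith
  then have "AE x in M. m x * s x * c x = 0"
    using nn integrable_m_s_mult[of c] c by (subst integral_nonneg_eq_0_iff_AE[symmetric]) auto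
  \<comment> \<open>Where \<open>s > 0\<close>, the vanishing product forces
    \<open>m x * c x = 0\<close>; elsewhere the right-hand side is \<open>m x\<close>, and
    \<open>c x \<le> 1\<close> suffices.\<close>
  then have "AE x in M. m x * c x \<le> m x * (if s x < 0 then 1 else if s x = 0 then 1 else 0)"
    using AE_space
    by eventually_elim (use c m_nonneg in \<open>auto simp: mult_left_le\<close>)
  then show ?thesis
    using c by (intro integral_mono_AE integrable_mult_m[where C = 1]) auto
qed

text \<open>Right continuity of the integral over \<open>{s \<le> a}\<close> gives \<open>jump\<close>: at the critical level the integral
  crosses zero, which is what puts \<open>t\<close> into the unit interval.\<close>

lemma threshold_optimal:
  fixes b t :: real
  defines "R \<equiv> \<lambda>A. LINT x:A|M. m x * s x"
  defines "L \<equiv> {x\<in>space M. s x < b}" and "E \<equiv> {x\<in>space M. s x = b}"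
  defines "c' \<equiv> \<lambda>x. if s x < b then 1 else if s x = b then t else 0"
  assumes b0: "0 \<le> b"
    and below: "\<And>a. a < b \<Longrightarrow> R {x\<in>space M. s x \<le> a} \<le> 0"
    and above: "\<And>a. b < a \<Longrightarrow> 0 \<le> R {x\<in>space M. s x \<le> a}"
    and t1: "R E = 0 \<Longrightarrow> t = 1" and t2: "R E > 0 \<Longrightarrow> t = - R L / R E"
  shows "0 \<le> t" "t \<le> 1" "t * (LINT x:E|M. m x) = (if 0 < b then - R L / b else (LINT x:E|M. m x))"
    "(LINT x|M. m x * s x * c' x) \<le> 0"
    "\<And>c. \<lbrakk>c \<in> borel_measurable M; \<And>x. x \<in> space M \<Longrightarrow> 0 \<le> c x \<and> c x \<le> 1;
       (LINT x|M. m x * s x * c x) \<le> 0\<rbrakk> \<Longrightarrow> (LINT x|M. m x * c x) \<le> (LINT x|M. m x * c' x)"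
proof -
  have L0: "R L \<le> 0"
    unfolding R_def L_def by (rule integral_below_nonpos) (use below in \<open>simp add: R_def\<close>)
  have "0 \<le> R {x\<in>space M. s x \<le> b}"
    unfolding R_def by (rule integral_upto_nonneg) (use above in \<open>simp add: R_def\<close>)
  then have jump: "0 \<le> R L + R E"
    unfolding R_def L_def E_def by (simp only: integral_upto_split)
  have E: "R E = b * (LINT x:E|M. m x)"
    unfolding R_def E_def by (rule integral_level)
  have mE: "0 \<le> (LINT x:E|M. m x)" unfolding E_def by (rule integral_level_nonneg)
  have E0: "0 \<le> R E" using E b0 mE by simp
  have t: "0 \<le> t \<and> t \<le> 1"
  proof (cases "R E = 0")
    case False
    then have pos: "0 < R E" using E0 by simp
    then show ?thesis using L0 jump unfolding t2[OF pos] by (simp add: field_simps)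
  qed (use t1 in simp)
  then show "0 \<le> t" "t \<le> 1" by auto
  \<comment> \<open>If \<open>R E = 0\<close>, then \<open>L0\<close> and \<open>jump\<close>
    squeeze \<open>R L\<close> to zero. So the constraint is tight in both cases of the definition
    of \<open>t\<close>.\<close>
  have tE: "t * R E = - R L" if "0 < b"
  proof (cases "R E = 0")
    case True then show ?thesis using L0 jump by simp
  next
    case False then show ?thesis using t2 E0 by simp
  qed
  show "t * (LINT x:E|M. m x) = (if 0 < b then - R L / b else (LINT x:E|M. m x))"
  proof (cases "0 < b")
    case True
    then have "b * (t * (LINT x:E|M. m x)) = - R L" using tE E by (simp add: mult.left_commute)
    then show ?thesis using True by (simp add: field_simps)
  next
    case False then show ?thesis using E b0 t1 by simp
  qed
  have Rc': "(LINT x|M. m x * s x * c' x) = R L + t * R E"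
    unfolding R_def L_def E_def c'_def
    by (rule integral_threshold) (auto intro: integrable_m_s)
  show c'0: "(LINT x|M. m x * s x * c' x) \<le> 0"
    using Rc' tE E L0 b0 by (cases "0 < b") auto
  show "(LINT x|M. m x * c x) \<le> (LINT x|M. m x * c' x)"
    if c: "c \<in> borel_measurable M" "\<And>x. x \<in> space M \<Longrightarrow> 0 \<le> c x \<and> c x \<le> 1"
       "(LINT x|M. m x * s x * c x) \<le> 0" for c
  proof (cases "0 < b")
    case True
    then show ?thesis
      unfolding c'_def using t c tE Rc' by (intro threshold_coverage_ge_pos) (auto simp: c'_def)
  next
    case False
    \<comment> \<open>A level set at height 0 carries no excess risk, so there is no jump, and
      \<open>L0\<close> with \<open>jump\<close> forces \<open>R L = 0\<close>.\<close>
    then have b: "b = 0" "R E = 0" using b0 E by auto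
    then have RL: "R L = 0" using L0 jump by simp
    have "c' = (\<lambda>x. if s x < 0 then 1 else if s x = 0 then 1 else 0)"
      unfolding c'_def b(1) t1[OF b(2)] ..
    then show ?thesis
      using threshold_coverage_ge_zero[OF RL[unfolded R_def L_def b(1)] c] by simp
  qed
qed

end

section \<open>From the joint density to the marginal and the conditional risk\<close>

text \<open>Tonelli's theorem turns the total mass 1 of the joint density into an iterated integral
  whose inner part is a finite sum over labels, namely the marginal.\<close>

lemma marginal_integral:
  assumes Y: "finite Y" and p: "prob_density M Y p"
  shows "marginal Y p \<in> borel_measurable M" "integrable M (marginal Y p)"
    "(LINT x|M. marginal Y p x) = 1"
    "\<And>x. x \<in> space M \<Longrightarrow> 0 \<le> marginal Y p x"
proof -
  \<comment> \<open>The labels are integrated first, so the sigma-finiteness used by Tonelli's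
    theorem is that of the label side.\<close>
  interpret C: sigma_finite_measure "count_space Y"
    using Y by (simp add: finite_measure_count_space finite_measure.sigma_finite_measure)
  have [measurable]: "p \<in> borel_measurable (M \<Otimes>\<^sub>M count_space Y)"
    and p0: "\<And>x y. x \<in> space M \<Longrightarrow> y \<in> Y \<Longrightarrow> 0 \<le> p (x, y)"
    and P: "prob_space (density (M \<Otimes>\<^sub>M count_space Y) (\<lambda>z. ennreal (p z)))"
    using p by (auto simp: prob_density_def)
  have [measurable]: "(\<lambda>x. p (x, y)) \<in> borel_measurable M" if "y \<in> Y" for y
    using that by (intro measurable_compose[OF _ \<open>p \<in> _\<close>] measurable_Pair) auto
  show m[measurable]: "marginal Y p \<in> borel_measurable M"
    unfolding marginal_def by measurable
  show m0: "\<And>x. x \<in> space M \<Longrightarrow> 0 \<le> marginal Y p x"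
    by (auto simp: marginal_def intro!: sum_nonneg p0)
  have "(\<integral>\<^sup>+z. ennreal (p z) \<partial>(M \<Otimes>\<^sub>M count_space Y)) = 1"
    using prob_space.emeasure_space_1[OF P]
    by (simp add: emeasure_density cong: nn_integral_cong)
  then have "(\<integral>\<^sup>+x. \<integral>\<^sup>+y. ennreal (p (x, y)) \<partial>count_space Y \<partial>M) = 1"
    by (subst C.nn_integral_fst) auto
  also have "(\<integral>\<^sup>+x. \<integral>\<^sup>+y. ennreal (p (x, y)) \<partial>count_space Y \<partial>M) = (\<integral>\<^sup>+x. ennreal (marginal Y p x) \<partial>M)"
    using Y p0 by (intro nn_integral_cong)
      (simp add: nn_integral_count_space_finite marginal_def sum_ennreal)
  finally have n: "(\<integral>\<^sup>+x. ennreal (marginal Y p x) \<partial>M) = ennreal 1" by simp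
  show "integrable M (marginal Y p)" "(LINT x|M. marginal Y p x) = 1"
    using nn_integral_eq_integrable[OF m, of 1] n m0 by auto
qed

text \<open>Supplies a bound that is uniform in \<open>x\<close>: a conditional probability is at
  most 1, and \<open>l y (h x)\<close> is one summand of the sum over all predictions
  \<open>y'\<close>.\<close>

lemma cond_risk_bounds:
  assumes "finite Y" and q: "cond_dist M Y p q"
    and l: "\<And>y y'. y \<in> Y \<Longrightarrow> y' \<in> Y \<Longrightarrow> 0 \<le> l y y'"
    and h: "h \<in> M \<rightarrow>\<^sub>M count_space Y" and x: "x \<in> space M"
  shows "0 \<le> cond_risk Y q l h x" "cond_risk Y q l h x \<le> (\<Sum>y\<in>Y. \<Sum>y'\<in>Y. l y y')"
proof -
  have hx: "h x \<in> Y" using measurable_space[OF h x] by simp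
  have q0: "0 \<le> q x y" if "y \<in> Y" for y using q x that by (auto simp: cond_dist_def)
  have q1: "q x y \<le> 1" if "y \<in> Y" for y
    using q x that member_le_sum[of y Y "q x"] q0 \<open>finite Y\<close> by (auto simp: cond_dist_def)
  show "0 \<le> cond_risk Y q l h x"
    using q0 l hx by (auto simp: cond_risk_def intro!: sum_nonneg mult_nonneg_nonneg)
  have "q x y * l y (h x) \<le> (\<Sum>y'\<in>Y. l y y')" if "y \<in> Y" for y
  proof -
    have "q x y * l y (h x) \<le> l y (h x)"
      using q0 q1 l hx that by (intro mult_left_le_one_le) auto
    also have "\<dots> \<le> (\<Sum>y'\<in>Y. l y y')"
      using \<open>finite Y\<close> l hx that by (intro member_le_sum) auto
    finally show ?thesis .
  qed
  then show "cond_risk Y q l h x \<le> (\<Sum>y\<in>Y. \<Sum>y'\<in>Y. l y y')"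
    unfolding cond_risk_def by (rule sum_mono)
qed

lemma cond_risk_measurable:
  assumes q: "cond_dist M Y p q" and [measurable]: "h \<in> M \<rightarrow>\<^sub>M count_space Y"
  shows "cond_risk Y q l h \<in> borel_measurable M"
proof -
  have [measurable]: "(\<lambda>x. q x y) \<in> borel_measurable M" if "y \<in> Y" for y
    using q that by (auto simp: cond_dist_def)
  \<comment> \<open>Every function out of a discrete space is measurable, so it remains to compose
    with \<open>h\<close>.\<close>
  have [measurable]: "(\<lambda>x. l y (h x)) \<in> borel_measurable M" for y
    by (rule measurable_compose[OF assms(2)]) simp
  show ?thesis unfolding cond_risk_def by measurable
qed

text \<open>Valid at points of zero marginal too: there the joint density vanishes at every label,
  whichever \<open>q\<close> is chosen.\<close>

lemma marginal_cond_risk: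
  assumes "cond_dist M Y p q" "x \<in> space M"
  shows "(\<Sum>y\<in>Y. p (x, y) * l y (h x)) = marginal Y p x * cond_risk Y q l h x"
  using assms by (simp add: cond_dist_def cond_risk_def sum_distrib_left mult.assoc)

section \<open>Reduction of the selective problem to threshold rules\<close>

theorem theorem3:
  fixes M :: "'x measure" and Y :: "'y set"
    and p :: "'x \<times> 'y \<Rightarrow> real" and q :: "'x \<Rightarrow> 'y \<Rightarrow> real"
    and l :: "'y \<Rightarrow> 'y \<Rightarrow> real" and h :: "'x \<Rightarrow> 'y" and lam :: real
    and r rbar cstar :: "'x \<Rightarrow> real" and \<rho> :: "'x set \<Rightarrow> real"
    and b \<gamma> :: ereal and \<tau> :: real
  assumes "finite Y"
    and "prob_density M Y p"
    and "cond_dist M Y p q"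
    and "\<And>y y'. y \<in> Y \<Longrightarrow> y' \<in> Y \<Longrightarrow> 0 \<le> l y y'"
    and "h \<in> M \<rightarrow>\<^sub>M count_space Y"
    and "0 < lam"
    and "\<exists>c. optimal_solution M Y p l h lam c"
    and "r = cond_risk Y q l h"
    and "rbar = (\<lambda>x. r x - lam)"
    and "\<rho> = rho M Y p rbar"
    and "b = Sup {a::ereal. a \<noteq> -\<infinity> \<and> \<rho> {x\<in>space M. ereal (rbar x) \<le> a} \<le> 0}"
    and "\<gamma> = b + ereal lam"
    and "\<rho> {x\<in>space M. ereal (r x) = \<gamma>} = 0 \<Longrightarrow> \<tau> = 1"
    and "\<rho> {x\<in>space M. ereal (r x) = \<gamma>} > 0 \<Longrightarrow>
           \<tau> = - \<rho> {x\<in>space M. ereal (r x) < \<gamma>} / \<rho> {x\<in>space M. ereal (r x) = \<gamma>}"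
    and "cstar = (\<lambda>x. if ereal (r x) < \<gamma> then 1 else if ereal (r x) = \<gamma> then \<tau> else 0)"
  shows "0 \<le> b
    \<and> (LINT x:{x\<in>space M. ereal (rbar x) < b}|M. marginal Y p x * cstar x)
        = (LINT x:{x\<in>space M. ereal (rbar x) < b}|M. marginal Y p x)
    \<and> (LINT x:{x\<in>space M. ereal (rbar x) = b}|M. marginal Y p x * cstar x)
        = (if b = \<infinity> then 0
           else if 0 < b then - \<rho> {x\<in>space M. ereal (rbar x) < b} / real_of_ereal b
           else (LINT x:{x\<in>space M. rbar x = 0}|M. marginal Y p x))
    \<and> (LINT x:{x\<in>space M. ereal (rbar x) > b}|M. marginal Y p x * cstar x) = 0
    \<and> optimal_solution M Y p l h lam cstar"
proof -
  let ?m = "marginal Y p"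
  note m = marginal_integral[OF assms(1,2)]
  have r_bounds: "0 \<le> r x" "r x \<le> (\<Sum>y\<in>Y. \<Sum>y'\<in>Y. l y y')" if "x \<in> space M" for x
    unfolding assms(8) by (rule cond_risk_bounds[OF assms(1,3) assms(4) assms(5) that]; assumption)+
  \<comment> \<open>As \<open>r \<ge> 0\<close>, the sum of losses controls \<open>r - lam\<close>
    from above and \<open>lam\<close> controls \<open>lam - r\<close>.\<close>
  define K where "K = (\<Sum>y\<in>Y. \<Sum>y'\<in>Y. l y y') + lam"
  interpret excess_risk M ?m rbar K
  proof
    show "rbar \<in> borel_measurable M"
      unfolding assms(8,9)
      by (intro borel_measurable_diff cond_risk_measurable[OF assms(3,5)]) simp
    show "\<bar>rbar x\<bar> \<le> K" if "x \<in> space M" for x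
      using r_bounds[OF that] \<open>0 < lam\<close> by (simp add: assms(9) K_def abs_le_iff)
  qed (use m in auto)
  have \<rho>: "\<rho> A = (LINT x:A|M. ?m x * rbar x)" for A by (simp add: assms(10) rho_def)
  have feasible: "feasible M Y p l h lam c \<longleftrightarrow>
      selection_function M c \<and> coverage M Y p c \<noteq> 0 \<and> (LINT x|M. ?m x * rbar x * c x) \<le> 0" for c
  proof (cases "selection_function M c \<and> coverage M Y p c \<noteq> 0")
    case True
    then have c: "c \<in> borel_measurable M" "\<And>x. x \<in> space M \<Longrightarrow> 0 \<le> c x \<and> c x \<le> 1"
      by (auto simp: selection_function_def)
    have "0 \<le> coverage M Y p c"
      unfolding coverage_def using c m(4) by (intro integral_nonneg_AE AE_I2) auto
    then have pos: "0 < coverage M Y p c" using True by auto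
    have i: "integrable M (\<lambda>x. ?m x * c x)" "integrable M (\<lambda>x. ?m x * rbar x * c x)"
      using c by (auto intro!: integrable_mult_m[where C = 1] integrable_m_s_mult)
    \<comment> \<open>Since \<open>r = rbar + lam\<close>, the numerator is the linear constraint
      plus \<open>lam\<close> times the coverage; \<open>pos\<close> then allows the denominator to
      be cleared.\<close>
    have "(LINT x|M. (\<Sum>y\<in>Y. p (x, y) * l y (h x)) * c x) =
        (LINT x|M. ?m x * rbar x * c x + lam * (?m x * c x))"
    proof (intro Bochner_Integration.integral_cong refl)
      fix x assume "x \<in> space M"
      from marginal_cond_risk[OF assms(3) this, of l h, folded assms(8)]
      show "(\<Sum>y\<in>Y. p (x, y) * l y (h x)) * c x = ?m x * rbar x * c x + lam * (?m x * c x)"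
        by (simp add: assms(9) algebra_simps)
    qed
    also have "\<dots> = (LINT x|M. ?m x * rbar x * c x) + lam * coverage M Y p c"
      using i by (simp add: coverage_def)
    finally show ?thesis
      using True pos by (simp add: feasible_def selective_risk_def divide_le_eq)
  qed (auto simp: feasible_def)
  \<comment> \<open>Maximality is asked against every solution of the linear constraint, even one of
    coverage zero. The assumed maximizer \<open>c0\<close> has positive coverage, so
    \<open>c'\<close> has it too and is feasible.\<close>
  have optimalI: "optimal_solution M Y p l h lam c'"
    if c': "selection_function M c'" "(LINT x|M. ?m x * rbar x * c' x) \<le> 0"
      and max: "\<And>c. \<lbrakk>c \<in> borel_measurable M; \<And>x. x \<in> space M \<Longrightarrow> 0 \<le> c x \<and> c x \<le> 1;
        (LINT x|M. ?m x * rbar x * c x) \<le> 0\<rbrakk> \<Longrightarrow> coverage M Y p c \<le> coverage M Y p c'" for c'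
  proof -
    have max': "coverage M Y p c \<le> coverage M Y p c'" if "feasible M Y p l h lam c" for c
      using that max unfolding feasible selection_function_def by blast
    obtain c0 where c0: "feasible M Y p l h lam c0"
      using assms(7) by (auto simp: optimal_solution_def is_arg_max_def)
    have "0 \<le> coverage M Y p c0"
      using c0 m(4) unfolding coverage_def
      by (intro integral_nonneg_AE AE_I2) (auto simp: feasible_def selection_function_def)
    then have "0 < coverage M Y p c'"
      using max'[OF c0] c0 by (simp add: feasible_def)
    then show ?thesis
      using c' max' by (fastforce simp: optimal_solution_def is_arg_max_def feasible)
  qed
  let ?S = "{a::ereal. a \<noteq> -\<infinity> \<and> \<rho> {x\<in>space M. ereal (rbar x) \<le> a} \<le> 0}"
  have "0 \<in> ?S" using integral_upto_nonpos[of 0] by (simp add: \<rho>)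
  then have b0: "0 \<le> b" unfolding assms(11) by (rule Sup_upper)
  show ?thesis
  proof (cases b)
    case PInf
    then have \<gamma>: "\<gamma> = \<infinity>" by (simp add: assms(12))
    then have cstar: "cstar = (\<lambda>_. 1)" by (simp add: assms(15))
    \<comment> \<open>An infinite supremum gives a level in \<open>?S\<close> beyond the bound
      \<open>K\<close>. Its sublevel set is the whole space, so selecting everything meets the
      constraint.\<close>
    have "ereal K < Sup ?S" using PInf by (simp add: assms(11))
    then obtain a where a: "a \<in> ?S" "ereal K < a" unfolding less_Sup_iff by blast
    have "ereal (rbar x) \<le> a" if "x \<in> space M" for x
      using s_bounded[OF that] a(2) by (meson abs_le_D1 ereal_less_eq(3) less_imp_le order_trans)
    then have "{x\<in>space M. ereal (rbar x) \<le> a} = space M" by auto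
    then have le: "(LINT x|M. ?m x * rbar x) \<le> 0"
      using a(1) set_integral_space[OF integrable_m_s] by (simp add: \<rho>)
    have "optimal_solution M Y p l h lam cstar"
    proof (rule optimalI)
      fix c assume c: "c \<in> borel_measurable M" "\<And>x. x \<in> space M \<Longrightarrow> 0 \<le> c x \<and> c x \<le> (1::real)"
      then have "integrable M (\<lambda>x. ?m x * c x)"
        by (auto intro!: integrable_mult_m[where C = 1])
      then show "coverage M Y p c \<le> coverage M Y p cstar"
        unfolding coverage_def cstar using m c(2)
        by (intro integral_mono) (auto intro: mult_left_le)
    qed (use le in \<open>auto simp: cstar selection_function_def\<close>)
    \<comment> \<open>A real excess risk neither equals nor exceeds \<open>b = \<infinity>\<close>,
      so the last two sets are empty and the first is the whole space.\<close>
    then show ?thesis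
      using PInf by (simp add: cstar set_lebesgue_integral_def)
  next
    case (real \<beta>)
    have \<beta>0: "0 \<le> \<beta>" using b0 real by simp
    have \<gamma>: "\<gamma> = ereal (\<beta> + lam)" by (simp add: assms(12) real)
    \<comment> \<open>Shifting by \<open>lam\<close> turns comparisons of \<open>r\<close> with
      \<open>\<gamma>\<close> into comparisons of \<open>rbar\<close> with \<open>\<beta>\<close>,
      so \<open>cstar\<close> and the conditions on \<open>\<tau>\<close> take the form used for
      threshold rules.\<close>
    have r_iff: "ereal (r x) < \<gamma> \<longleftrightarrow> rbar x < \<beta>" "ereal (r x) = \<gamma> \<longleftrightarrow> rbar x = \<beta>" for x
      by (auto simp: \<gamma> assms(9))
    have cstar: "cstar x = (if rbar x < \<beta> then 1 else if rbar x = \<beta> then \<tau> else 0)" for x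
      unfolding assms(15) r_iff ..
    \<comment> \<open>Lying below the supremum does not by itself put \<open>a\<close> into
      \<open>?S\<close>. Monotonicity transfers the sign from a larger member of \<open>?S\<close>,
      but only for levels from 0 on.\<close>
    have below: "(LINT x:{x\<in>space M. rbar x \<le> a}|M. ?m x * rbar x) \<le> 0" if "a < \<beta>" for a
    proof (cases "a \<le> 0")
      case True then show ?thesis by (rule integral_upto_nonpos)
    next
      case False
      have "ereal a < Sup ?S" using that real by (simp add: assms(11))
      then obtain a' where a': "a' \<in> ?S" "ereal a < a'" unfolding less_Sup_iff by blast
      have "a' \<le> b" unfolding assms(11) using a'(1) by (rule Sup_upper)
      \<comment> \<open>The level is finite: \<open>?S\<close> excludes \<open>-\<infinity>\<close>,
        and \<open>b\<close> is a real upper bound.\<close>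
      then obtain a'' where a'': "a' = ereal a''" using a'(1) real by (cases a') auto
      have "(LINT x:{x\<in>space M. rbar x \<le> a}|M. ?m x * rbar x)
          \<le> (LINT x:{x\<in>space M. rbar x \<le> a''}|M. ?m x * rbar x)"
        using False a'(2) a'' by (intro integral_upto_mono) auto
      then show ?thesis using a'(1) a'' by (simp add: \<rho>)
    qed
    have above: "0 \<le> (LINT x:{x\<in>space M. rbar x \<le> a}|M. ?m x * rbar x)" if "\<beta> < a" for a
    proof (rule ccontr)
      assume "\<not> ?thesis"
      then have "ereal a \<in> ?S" by (simp add: \<rho>)
      then have "ereal a \<le> b" unfolding assms(11) by (rule Sup_upper)
      then show False using that real by simp
    qed
    note opt = threshold_optimal[OF \<beta>0 below above assms(13,14)[unfolded r_iff \<rho>], folded cstar]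
    have "(LINT x:{x\<in>space M. rbar x < \<beta>}|M. ?m x * cstar x)
        = (LINT x:{x\<in>space M. rbar x < \<beta>}|M. ?m x)"
      by (rule set_lebesgue_integral_cong) (auto simp: cstar)
    \<comment> \<open>On the level set \<open>cstar\<close> is the constant \<open>\<tau>\<close>,
      so the integral is \<open>\<tau>\<close> times the mass of that set, which
      \<open>opt(3)\<close> evaluates.\<close>
    moreover have "(LINT x:{x\<in>space M. rbar x = \<beta>}|M. ?m x * cstar x)
        = (LINT x:{x\<in>space M. rbar x = \<beta>}|M. \<tau> * ?m x)"
      by (rule set_lebesgue_integral_cong) (auto simp: cstar)
    moreover have "(LINT x:{x\<in>space M. \<beta> < rbar x}|M. ?m x * cstar x)
        = (LINT x:{x\<in>space M. \<beta> < rbar x}|M. 0)"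
      by (rule set_lebesgue_integral_cong) (auto simp: cstar)
    moreover have "optimal_solution M Y p l h lam cstar"
    proof (rule optimalI)
      have "cstar \<in> borel_measurable M" unfolding cstar[abs_def] by measurable
      then show "selection_function M cstar"
        using opt(1,2) by (auto simp: selection_function_def cstar)
    qed (use opt(4,5) in \<open>simp_all add: coverage_def\<close>)
    ultimately show ?thesis
      using b0 \<beta>0 opt(3) by (auto simp: real \<rho> set_lebesgue_integral_def)
  qed (use b0 in simp)
qed

end
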